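(* Let $(p_n)_{n\ge0}$ be the sequence of polynomials defined by $p_0(\alpha)=1$ and $$p_{n+1}(\alpha)=\frac{\alpha}{n+1}\sum_{k=0}^n\frac{k+1}{k+2}\,p_{n-k}(\alpha),\quad n\ge0$$ (so $p_1(\alpha)=\frac{\alpha}{2}$, $p_2(\alpha)=\frac{\alpha}{3}+\frac{\alpha^2}{8}$). For every $\alpha\in\mathbb{C}$ the entire function $\varphi_\alpha$ has the power series $$\varphi_\alpha(s)=e^\alpha\sum_{n=0}^\infty(-1)^np_{n+1}(\alpha)\frac{s^n}{n!},\quad s\in\mathbb{C}.$$ In particular $\varphi_\alpha(0)=e^\alpha\alpha/2$.
   Context: For $\alpha\in\mathbb{C}$ let $f_\alpha(z)=e^\alpha-\exp(\alpha z\,\mathrm{Log}(1+1/z))$ for $z\in\mathbb{C}\setminus[-1,0]$, with $\mathrm{Log}$ the principal logarithm; $f_\alpha(z)\to e^\alpha-1$ as $z\to0$ within $\mathbb{C}\setminus]-\infty,0]$. The entire function $\varphi_\alpha$ is defined by $$\varphi_\alpha(s)=\frac{1}{2\pi i}\int_{C(r,c)}f_\alpha(z)e^{sz}\,dz,\quad s\in\mathbb{C},$$ where $c>1$, $r>0$ and $C(r,c)$ is the positively oriented boundary of the rectangle with corners $-c\pm ir$, $\pm ir$ (with $f_\alpha(0):=e^\alpha-1$ on the side $[-ir,ir]$); the value does not depend on $c>1$, $r>0$. *)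

theory Defs
  imports "HOL-Complex_Analysis.Complex_Analysis"
    "HOL-Computational_Algebra.Polynomial"
begin

text \<open>
  The function is used off the cut \<open>[-1,0]\<close> and at the point \<open>0\<close>, where it takes its
  limit from \<open>\<complex> \<setminus> ]-\<infinity>,0]\<close>; the values on the rest of the cut are irrelevant.
\<close>

definition f_alpha :: "complex \<Rightarrow> complex \<Rightarrow> complex" where
  "f_alpha \<alpha> z = (if z = 0 then exp \<alpha> - 1 else exp \<alpha> - exp (\<alpha> * z * Ln (1 + 1 / z)))"

text \<open>
  The path \<open>rectpath a b\<close> runs through \<open>a\<close>, the lower right corner, \<open>b\<close> and the upper left
  corner, hence is positively oriented for \<open>a\<close> the lower left and \<open>b\<close> the upper right corner.
\<close>

definition C_rect :: "real \<Rightarrow> real \<Rightarrow> real \<Rightarrow> complex" where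
  "C_rect r c = rectpath (Complex (- c) (- r)) (Complex 0 r)"

text \<open>
  The contour parameters remain explicit arguments; the value is meant for \<open>c > 1\<close>, \<open>r > 0\<close>.
\<close>

definition phi :: "real \<Rightarrow> real \<Rightarrow> complex \<Rightarrow> complex \<Rightarrow> complex" where
  "phi r c \<alpha> s =
     1 / (2 * complex_of_real pi * \<i>) * contour_integral (C_rect r c) (\<lambda>z. f_alpha \<alpha> z * exp (s * z))"

fun p_poly :: "nat \<Rightarrow> complex poly" where
  "p_poly 0 = 1"
| "p_poly (Suc n) =
     smult (1 / (of_nat n + 1)) ([:0, 1:] *
       (\<Sum>k=0..n. smult ((of_nat k + 1) / (of_nat k + 2)) (p_poly (n - k))))"

end

theory Submission
  imports Defs "HOL-Real_Asymp.Real_Asymp"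
begin

text \<open>
  The coefficient of \<open>s^n / n!\<close> in \<open>phi r c \<alpha> s\<close> is, after expanding \<open>exp (s * z)\<close> under the
  integral sign, the moment \<open>\<oint> f z * z^n dz / (2 \<pi> \<i>)\<close> of \<open>f = f_alpha \<alpha>\<close>. The substitution
  \<open>w = 1 / z\<close> turns the exponent \<open>\<alpha> * z * Ln (1 + 1 / z)\<close> into \<open>\<alpha> * Ln (1 + w) / w\<close>, which is
  holomorphic in the unit disc, so for \<open>norm z > 1\<close> the function \<open>f\<close> is a power series in \<open>1 / z\<close>.
  On a contour around the closed unit disc the moment of order \<open>n\<close> is therefore just the coefficient
  of that series at \<open>n + 1\<close> (lemma \<open>has_contour_integral_eval_fps_inverse\<close>).

  Two things are left. The first is to move the given contour outwards. Its right side
  runs through the end \<open>0\<close> of the cut, where \<open>f\<close> is not holomorphic but still continuous because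
  \<open>z * Ln (1 + 1 / z)\<close> tends to \<open>0\<close>. This is enough for Cauchy's theorem on a rectangle that has this
  side in its boundary, so the side can be pushed to the right; the new rectangle contains the cut in
  its interior, and dilating it from the midpoint of the cut is a homotopy that avoids the cut
  (lemma \<open>f_alpha_moment\<close>). The second is to identify the coefficients. The series of
  \<open>exp (\<alpha> * (Ln (1 + w) / w - 1))\<close> satisfies a linear first-order differential equation, and
  comparing coefficients in that equation gives, up to the signs \<open>(-1)^n\<close>, the recursion of the
  polynomials (lemma \<open>p_gen_fps_eq_exp\<close>).
\<close>

section \<open>Contour integrals over rectangles\<close>

lemma has_contour_integral_rectpath:
  assumes "continuous_on (path_image (rectpath a b)) f"
      and "Re a \<le> Re b" "Im a \<le> Im b"
  shows "(f has_contour_integral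
      (contour_integral (linepath a (Complex (Re b) (Im a))) f +
       contour_integral (linepath (Complex (Re b) (Im a)) b) f +
       contour_integral (linepath b (Complex (Re a) (Im b))) f +
       contour_integral (linepath (Complex (Re a) (Im b)) a) f)) (rectpath a b)"
proof -
  define a2 a4 where "a2 = Complex (Re b) (Im a)" and "a4 = Complex (Re a) (Im b)"
  have im: "path_image (rectpath a b) =
      closed_segment a a2 \<union> closed_segment a2 b \<union> closed_segment b a4 \<union> closed_segment a4 a"
    by (simp add: rectpath_def Let_def path_image_join a2_def a4_def Un_assoc)
  have int: "(f has_contour_integral contour_integral (linepath u v) f) (linepath u v)"
    if "closed_segment u v \<subseteq> path_image (rectpath a b)" for u v
    using that assms(1) continuous_on_subset
    by (blast intro: has_contour_integral_integral contour_integrable_continuous_linepath)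
  have "(f has_contour_integral
      (contour_integral (linepath a a2) f + (contour_integral (linepath a2 b) f +
       (contour_integral (linepath b a4) f + contour_integral (linepath a4 a) f)))) (rectpath a b)"
    unfolding rectpath_def Let_def a2_def[symmetric] a4_def[symmetric]
    by (intro has_contour_integral_join int) (auto simp: im)
  then show ?thesis
    by (simp add: a2_def a4_def add.assoc)
qed

lemmas contour_integral_rectpath =
  has_contour_integral_rectpath [THEN contour_integral_unique]

text \<open>
  The limit is taken on each side separately, since termwise integration along a
  segment follows from uniform convergence alone.
\<close>

lemma contour_integral_rectpath_sums:
  assumes u: "uniform_limit (path_image (rectpath a b)) (\<lambda>N w. \<Sum>n<N. f n w) g sequentially"
    and c: "\<And>n. continuous_on (path_image (rectpath a b)) (f n)"
    and le: "Re a \<le> Re b" "Im a \<le> Im b"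
  shows "(\<lambda>n. contour_integral (rectpath a b) (f n)) sums contour_integral (rectpath a b) g"
proof -
  define a2 a4 where "a2 = Complex (Re b) (Im a)" and "a4 = Complex (Re a) (Im b)"
  have im: "path_image (rectpath a b) =
      closed_segment a a2 \<union> closed_segment a2 b \<union> closed_segment b a4 \<union> closed_segment a4 a"
    by (simp add: rectpath_def Let_def path_image_join a2_def a4_def Un_assoc)
  have side: "(\<lambda>n. contour_integral (linepath u v) (f n)) sums contour_integral (linepath u v) g"
    if uv: "closed_segment u v \<subseteq> path_image (rectpath a b)" for u v
  proof (rule contour_integral_sums_linepath)
    show "uniform_limit (closed_segment u v) (\<lambda>N w. \<Sum>n<N. f n w) g sequentially"
      using uniform_limit_on_subset[OF u uv] .
    show "continuous_on (closed_segment u v) (f n)" for n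
      using continuous_on_subset[OF c uv] .
  qed (use contour_integral_unique in blast)
  have cg: "continuous_on (path_image (rectpath a b)) g"
    by (rule uniform_limit_theorem[OF _ u]) (auto intro!: always_eventually continuous_intros c)
  show ?thesis
    unfolding contour_integral_rectpath[OF c le] contour_integral_rectpath[OF cg le]
    by (intro sums_add side) (auto simp: im a2_def a4_def)
qed

text \<open>
  On the compact contour the terms are dominated by those of the series of
  \<open>B * exp (R * norm s)\<close>, where \<open>B\<close> bounds \<open>f\<close> and \<open>R\<close> bounds \<open>z\<close>, so that the sum may be
  integrated term by term.
\<close>

lemma contour_integral_rectpath_exp_sums:
  assumes f: "continuous_on (path_image (rectpath a b)) f"
    and le: "Re a \<le> Re b" "Im a \<le> Im b"
  shows "(\<lambda>n. contour_integral (rectpath a b) (\<lambda>z. f z * z ^ n) * (s ^ n / fact n))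
           sums contour_integral (rectpath a b) (\<lambda>z. f z * exp (s * z))"
proof -
  let ?P = "path_image (rectpath a b)"
  have "compact ?P"
    by (simp add: compact_path_image)
  then have "bounded (f ` ?P)" "bounded ?P"
    using f compact_continuous_image compact_imp_bounded by blast+
  then obtain B R where B: "\<And>z. z \<in> ?P \<Longrightarrow> norm (f z) \<le> B" and R: "\<And>z. z \<in> ?P \<Longrightarrow> norm z \<le> R"
    unfolding bounded_iff by auto
  have "a \<in> ?P"
    using pathstart_in_path_image[of "rectpath a b"] by simp
  with B R have "0 \<le> B" "0 \<le> R"
    by (meson norm_ge_zero order_trans)+
  have "uniform_limit ?P (\<lambda>N z. \<Sum>n<N. f z * z ^ n * (s ^ n / fact n))
      (\<lambda>z. \<Sum>n. f z * z ^ n * (s ^ n / fact n)) sequentially"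
  proof (rule Weierstrass_m_test)
    fix n z assume z: "z \<in> ?P"
    have "norm (f z * z ^ n * (s ^ n / fact n)) = norm (f z) * norm z ^ n * (norm s ^ n / fact n)"
      by (simp add: norm_mult norm_divide norm_power)
    also have "\<dots> \<le> B * R ^ n * (norm s ^ n / fact n)"
      using B[OF z] R[OF z] \<open>0 \<le> B\<close> \<open>0 \<le> R\<close> by (intro mult_mono power_mono) auto
    also have "\<dots> = B * ((R * norm s) ^ n /\<^sub>R fact n)"
      by (simp add: power_mult_distrib field_simps)
    finally show "norm (f z * z ^ n * (s ^ n / fact n)) \<le> B * ((R * norm s) ^ n /\<^sub>R fact n)" .
  qed (intro summable_mult summable_exp_generic)
  also have "(\<lambda>z. \<Sum>n. f z * z ^ n * (s ^ n / fact n)) = (\<lambda>z. f z * exp (s * z))"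
  proof
    fix z
    have "(\<lambda>n. f z * ((s * z) ^ n /\<^sub>R fact n)) sums (f z * exp (s * z))"
      by (intro sums_mult exp_converges)
    then show "(\<Sum>n. f z * z ^ n * (s ^ n / fact n)) = f z * exp (s * z)"
      by (simp add: sums_iff power_mult_distrib scaleR_conv_of_real field_simps)
  qed
  finally have "(\<lambda>n. contour_integral (rectpath a b) (\<lambda>z. f z * z ^ n * (s ^ n / fact n)))
      sums contour_integral (rectpath a b) (\<lambda>z. f z * exp (s * z))"
    by (rule contour_integral_rectpath_sums) (intro continuous_intros f le)+
  moreover have "contour_integral (rectpath a b) (\<lambda>z. f z * z ^ n * (s ^ n / fact n)) =
      contour_integral (rectpath a b) (\<lambda>z. f z * z ^ n) * (s ^ n / fact n)" for n
  proof -
    have "(\<lambda>z. f z * z ^ n) contour_integrable_on rectpath a b"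
      unfolding contour_integrable_on_def
      by (rule exI, rule has_contour_integral_rectpath) (intro continuous_intros f le)+
    then show ?thesis
      by (rule contour_integral_rmul)
  qed
  ultimately show ?thesis
    by simp
qed

text \<open>
  The two contours differ by the boundary of the rectangle between the two right sides, over
  which the integral vanishes. Asking only for continuity on the closed rectangle allows the old right
  side to pass through singularities such as the branch point \<open>0\<close> of \<open>f_alpha\<close>.
\<close>

lemma contour_integral_rectpath_move_right_side:
  assumes le: "Re a \<le> x" "x \<le> y" "Im a \<le> t"
    and cont: "continuous_on (path_image (rectpath a (Complex x t)) \<union> cbox (Complex x (Im a)) (Complex y t)) f"
    and diff: "\<And>z. z \<in> box (Complex x (Im a)) (Complex y t) \<Longrightarrow> f field_differentiable at z"
  shows "contour_integral (rectpath a (Complex x t)) f = contour_integral (rectpath a (Complex y t)) f"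
proof -
  let ?R = "cbox (Complex x (Im a)) (Complex y t)"
  let ?P = "path_image (rectpath a (Complex x t))"
  have *: "path_image (rectpath a (Complex y t)) \<subseteq> ?P \<union> ?R"
    "closed_segment a (Complex y (Im a)) \<subseteq> ?P \<union> ?R"
    "closed_segment (Complex y t) (Complex (Re a) t) \<subseteq> ?P \<union> ?R"
    "Complex x (Im a) \<in> closed_segment a (Complex y (Im a))"
    "Complex x t \<in> closed_segment (Complex y t) (Complex (Re a) t)"
    "path_image (rectpath (Complex x (Im a)) (Complex y t)) \<subseteq> ?R"
    "closed_segment (Complex x (Im a)) (Complex x t) \<subseteq> ?R"
    using le
    by (auto simp: path_image_rectpath in_cbox_complex_iff closed_segment_same_Im
        closed_segment_same_Re closed_segment_eq_real_ivl split: if_splits)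
  note c = continuous_on_subset[OF cont]
  have "(f has_contour_integral 0) (rectpath (Complex x (Im a)) (Complex y t))"
    by (rule Cauchy_theorem_convex[where S = ?R and K = "{}"])
       (use * diff in \<open>auto intro: c simp: interior_cbox\<close>)
  then have 0: "contour_integral (rectpath (Complex x (Im a)) (Complex y t)) f = 0"
    by (rule contour_integral_unique)
  have cR: "continuous_on (path_image (rectpath (Complex x (Im a)) (Complex y t))) f"
    and cy: "continuous_on (path_image (rectpath a (Complex y t))) f"
    and cx: "continuous_on ?P f"
    and cs: "continuous_on (closed_segment (Complex x (Im a)) (Complex x t)) f"
    using * by (auto intro!: c)
  note bottom = contour_integral_split_linepath[OF c[OF *(2)] *(4)]
  note top = contour_integral_split_linepath[OF c[OF *(3)] *(5)]
  note left = contour_integral_reverse_linepath[OF cs]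
  have le': "Re a \<le> y"
    using le by simp
  have "contour_integral (rectpath (Complex x (Im a)) (Complex y t)) f =
      contour_integral (rectpath a (Complex y t)) f - contour_integral (rectpath a (Complex x t)) f"
    using contour_integral_rectpath[OF cR] contour_integral_rectpath[OF cx]
      contour_integral_rectpath[OF cy] le le'
    by (simp add: bottom top left)
  with 0 show ?thesis
    by simp
qed

lemma rectpath_dilate:
  "rectpath (p + of_real k * (a - p)) (p + of_real k * (b - p)) t = p + of_real k * (rectpath a b t - p)"
proof -
  define D where "D = (\<lambda>z. p + of_real k * (z - p))"
  have corner: "Complex (Re (D x)) (Im (D y)) = D (Complex (Re x) (Im y))" for x y
    by (simp add: D_def complex_eq_iff)
  have side: "linepath (D x) (D y) u = D (linepath x y u)" for x y u
    by (simp add: D_def linepath_def scaleR_conv_of_real algebra_simps)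
  have "rectpath (D a) (D b) t = D (rectpath a b t)"
    by (simp add: rectpath_def Let_def joinpaths_def corner side)
  then show ?thesis
    by (simp add: D_def)
qed

text \<open>
  A point of the contour moves away from \<open>p\<close> on a ray. It cannot reenter the open rectangle, because
  its starting point lies between \<open>p\<close> and the moving point and the rectangle is convex; so the
  homotopy stays where \<open>f\<close> is holomorphic, whatever happens inside the rectangle.
\<close>

lemma contour_integral_rectpath_dilate:
  assumes p: "p \<in> box a b" and k: "k \<ge> 1"
    and f: "open S" "f holomorphic_on S" "- box a b \<subseteq> S"
  shows "contour_integral (rectpath a b) f =
    contour_integral (rectpath (p + of_real k * (a - p)) (p + of_real k * (b - p))) f"
proof (rule Cauchy_theorem_homotopic_loops[OF _ f(1,2)])
  let ?h = "rectpath (p + of_real k * (a - p)) (p + of_real k * (b - p))"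
  have le: "Re a \<le> Re b" "Im a \<le> Im b"
    using p by (auto simp: in_box_complex_iff)
  show "homotopic_loops S (rectpath a b) ?h"
  proof (rule homotopic_loops_linear)
    fix t :: real assume "t \<in> {0..1}"
    define x where "x = rectpath a b t"
    have x: "x \<notin> box a b"
      using \<open>t \<in> {0..1}\<close> path_image_rectpath_inter_box[OF le] by (force simp: x_def path_image_def)
    show "closed_segment (rectpath a b t) (?h t) \<subseteq> S"
    proof
      fix q assume "q \<in> closed_segment (rectpath a b t) (?h t)"
      then obtain u where u: "0 \<le> u" "u \<le> 1" "q = (1 - u) *\<^sub>R x + u *\<^sub>R (p + of_real k * (x - p))"
        unfolding rectpath_dilate closed_segment_def x_def by auto
      define m where "m = 1 + u * (k - 1)"
      have m: "m \<ge> 1"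
        using k u by (simp add: m_def)
      have "q = p + of_real m * (x - p)"
        by (simp add: u(3) m_def scaleR_conv_of_real algebra_simps)
      then have "x = (1 - 1 / m) *\<^sub>R p + (1 / m) *\<^sub>R q"
        using m by (simp add: scaleR_conv_of_real field_simps)
      then have "q \<in> box a b \<Longrightarrow> x \<in> box a b"
        using convexD[OF convex_box(2) p, of q "1 - 1 / m" "1 / m"] m by simp
      with x f(3) show "q \<in> S"
        by auto
    qed
  qed simp_all
qed simp_all

section \<open>Coefficients at infinity\<close>

text \<open>
  Splitting off the constant term, \<open>A(1/z) = A_0 + B(1/z) / z\<close> with the shifted series \<open>B\<close>,
  reduces the exponent \<open>m + 1\<close> for \<open>A\<close> to the exponent \<open>m\<close> for \<open>B\<close>, as \<open>A_0 * z^m\<close> is entire.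
  For \<open>m = 0\<close> the first part contributes the winding number and the second, \<open>B(1/z) / z^2\<close>,
  has the primitive \<open>- S(1/z)\<close> with \<open>S' = B\<close>. This avoids uniform convergence of a Laurent series.
\<close>

lemma has_contour_integral_eval_fps_inverse:
  assumes A: "1 \<le> fps_conv_radius A"
    and g: "valid_path g" "pathfinish g = pathstart g"
    and out: "path_image g \<inter> cball 0 1 = {}" and wn: "winding_number g 0 = 1"
  shows "((\<lambda>z. eval_fps A (1 / z) * z ^ m / z) has_contour_integral
           2 * of_real pi * \<i> * fps_nth A m) g"
  using A
proof (induction m arbitrary: A)
  have nz: "z \<noteq> 0" and inv: "1 / z \<in> ball 0 1" if "z \<in> path_image g" for z
    using out that by (auto simp: disjoint_iff norm_divide divide_simps)
  have split: "eval_fps A (1 / z) = fps_nth A 0 + eval_fps (fps_shift 1 A) (1 / z) / z"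
    if "z \<in> path_image g" "1 \<le> fps_conv_radius A" for z and A :: "complex fps"
  proof -
    have "ereal (norm (1 / z)) < fps_conv_radius A"
      using inv[OF that(1)] that(2) by (intro less_le_trans[of _ 1 "fps_conv_radius A"]) auto
    then have "(\<lambda>n. fps_nth A n * (1 / z) ^ n) sums eval_fps A (1 / z)"
      by (rule sums_eval_fps)
    then have "(\<lambda>n. fps_nth A (Suc n) * (1 / z) ^ Suc n) sums (eval_fps A (1 / z) - fps_nth A 0)"
      by (subst sums_Suc_iff) simp
    moreover have "(\<lambda>n. fps_nth (fps_shift 1 A) n * (1 / z) ^ n * (1 / z)) sums
        (eval_fps (fps_shift 1 A) (1 / z) * (1 / z))"
      using \<open>ereal (norm (1 / z)) < fps_conv_radius A\<close>
      by (intro sums_mult2 sums_eval_fps) simp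
    ultimately show ?thesis
      by (auto dest: sums_unique2 simp: mult_ac)
  qed
  {
    case (0 A)
    define B where "B = fps_shift 1 A"
    have "ball 0 1 \<subseteq> eball 0 (fps_conv_radius B)"
      using 0 eball_mono[of 1 "fps_conv_radius B" 0] by (simp add: B_def one_ereal_def eball_ereal)
    then have "eval_fps B holomorphic_on ball 0 1"
      by (rule holomorphic_on_eval_fps)
    then obtain S where
      "\<And>w. w \<in> ball 0 1 \<Longrightarrow> (S has_field_derivative eval_fps B w) (at w within ball 0 1)"
      using holomorphic_convex_primitive'[of "ball 0 1" "eval_fps B"] by blast
    then have S: "(S has_field_derivative eval_fps B w) (at w)" if "w \<in> ball 0 1" for w
      using that at_within_open[OF that open_ball] by metis
    have "((\<lambda>z. eval_fps B (1 / z) / z ^ 2) has_contour_integral 0) g"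
    proof (rule Cauchy_theorem_primitive)
      fix z assume z: "z \<in> path_image g"
      show "((\<lambda>z. - S (1 / z)) has_field_derivative eval_fps B (1 / z) / z ^ 2)
          (at z within path_image g)"
        using nz[OF z]
        by (auto intro!: derivative_eq_intros DERIV_chain2[where g = "\<lambda>z. 1 / z", OF S[OF inv[OF z]]]
            simp: power2_eq_square)
    qed (use g in auto)
    moreover have "((\<lambda>z. fps_nth A 0 * (1 / (z - 0))) has_contour_integral
        fps_nth A 0 * (2 * of_real pi * \<i> * winding_number g 0)) g"
      using g nz has_contour_integral_winding_number[of g 0]
      by (intro has_contour_integral_lmul) auto
    ultimately have "((\<lambda>z. fps_nth A 0 * (1 / (z - 0)) + eval_fps B (1 / z) / z ^ 2)
        has_contour_integral fps_nth A 0 * (2 * of_real pi * \<i> * winding_number g 0) + 0) g"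
      by (intro has_contour_integral_add)
    then have "((\<lambda>z. eval_fps A (1 / z) * z ^ 0 / z) has_contour_integral
        fps_nth A 0 * (2 * of_real pi * \<i> * winding_number g 0) + 0) g"
      by (rule has_contour_integral_eq)
         (use nz in \<open>auto simp: split[OF _ 0] B_def field_simps power2_eq_square\<close>)
    then show ?case
      by (simp add: wn mult_ac)
  next
    case (Suc m A)
    have "((\<lambda>z. fps_nth A 0 * z ^ m) has_contour_integral 0) g"
      by (rule Cauchy_theorem_convex_simple[of _ UNIV]) (use g in \<open>auto intro!: holomorphic_intros\<close>)
    moreover have "((\<lambda>z. eval_fps (fps_shift 1 A) (1 / z) * z ^ m / z) has_contour_integral
        2 * of_real pi * \<i> * fps_nth (fps_shift 1 A) m) g"
      by (rule Suc.IH) (use Suc.prems in simp)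
    ultimately have "((\<lambda>z. fps_nth A 0 * z ^ m + eval_fps (fps_shift 1 A) (1 / z) * z ^ m / z)
        has_contour_integral 0 + 2 * of_real pi * \<i> * fps_nth (fps_shift 1 A) m) g"
      by (rule has_contour_integral_add)
    then have "((\<lambda>z. eval_fps A (1 / z) * z ^ Suc m / z) has_contour_integral
        0 + 2 * of_real pi * \<i> * fps_nth (fps_shift 1 A) m) g"
      by (rule has_contour_integral_eq)
         (use nz in \<open>auto simp: split[OF _ Suc.prems] field_simps\<close>)
    then show ?case
      by simp
  }
qed

section \<open>The generating function of the polynomials\<close>

definition Ln_quotient :: "complex \<Rightarrow> complex" where
  "Ln_quotient w = (if w = 0 then 1 else Ln (1 + w) / w)"

definition Ln_quotient_fps :: "complex fps" where
  "Ln_quotient_fps = Abs_fps (\<lambda>n. (-1) ^ n / (of_nat n + 1))"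

lemma Ln_quotient_holomorphic: "Ln_quotient holomorphic_on ball 0 1"
proof -
  have pos: "1 + w \<notin> \<real>\<^sub>\<le>\<^sub>0" if "w \<in> ball 0 1" for w :: complex
  proof -
    have "\<bar>Re w\<bar> < 1"
      using that abs_Re_le_cmod[of w] by simp
    then show ?thesis
      by (auto simp: complex_nonpos_Reals_iff)
  qed
  have "(\<lambda>w. Ln (1 + w)) holomorphic_on ball 0 1"
    using pos by (auto intro!: holomorphic_intros)
  then have "(\<lambda>w. if w = 0 then deriv (\<lambda>w. Ln (1 + w)) 0 else (Ln (1 + w) - Ln (1 + 0)) / (w - 0))
      holomorphic_on ball 0 1"
    by (rule pole_lemma_open) simp
  moreover have "deriv (\<lambda>w. Ln (1 + w)) 0 = 1"
    by (rule DERIV_imp_deriv) (auto intro!: derivative_eq_intros)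
  ultimately show ?thesis
    by (simp add: Ln_quotient_def[abs_def] cong: if_cong)
qed

lemma Ln_quotient_has_fps_expansion: "Ln_quotient has_fps_expansion Ln_quotient_fps"
proof (rule has_fps_expansionI)
  have "(\<lambda>n. fps_nth Ln_quotient_fps n * w ^ n) sums Ln_quotient w" if "w \<in> ball 0 1" for w
  proof (cases "w = 0")
    case True
    then show ?thesis
      using powser_sums_zero[of "fps_nth Ln_quotient_fps"]
      by (simp add: Ln_quotient_def Ln_quotient_fps_def)
  next
    case False
    have "(\<lambda>n. (-1) ^ Suc n / of_nat n * w ^ n) sums Ln (1 + w)"
      using that by (intro Ln_series) simp
    then have "(\<lambda>n. (-1) ^ Suc (Suc n) / of_nat (Suc n) * w ^ Suc n) sums Ln (1 + w)"
      by (subst sums_Suc_iff) simp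
    then have "(\<lambda>n. (-1) ^ Suc (Suc n) / of_nat (Suc n) * w ^ Suc n / w) sums (Ln (1 + w) / w)"
      by (rule sums_divide)
    then show ?thesis
      using False by (simp add: Ln_quotient_def Ln_quotient_fps_def add.commute)
  qed
  then show "\<forall>\<^sub>F w in nhds 0. (\<lambda>n. fps_nth Ln_quotient_fps n * w ^ n) sums Ln_quotient w"
    unfolding eventually_nhds by (intro exI[of _ "ball 0 1"]) auto
qed

text \<open>
  The signs are those of the series of \<open>Ln (1 + w)\<close>; without them one has the generating function
  of the polynomials themselves.
\<close>

definition p_gen_fps :: "complex \<Rightarrow> complex fps" where
  "p_gen_fps \<alpha> = Abs_fps (\<lambda>n. (-1) ^ n * poly (p_poly n) \<alpha>)"

lemma p_gen_fps_0: "fps_nth (p_gen_fps \<alpha>) 0 = 1"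
  by (simp add: p_gen_fps_def)

text \<open>
  The coefficients of \<open>fps_deriv Ln_quotient_fps\<close> are, up to sign, the weights
  \<open>(k + 1) / (k + 2)\<close> in the recursion, so this equation is the recursion itself.
\<close>

lemma p_gen_fps_deriv:
  "fps_deriv (p_gen_fps \<alpha>) = fps_const \<alpha> * fps_deriv Ln_quotient_fps * p_gen_fps \<alpha>"
proof (rule fps_ext)
  fix n
  have "fps_nth (fps_deriv (p_gen_fps \<alpha>)) n =
      (-1) ^ Suc n * \<alpha> * (\<Sum>k=0..n. (of_nat k + 1) / (of_nat k + 2) * poly (p_poly (n - k)) \<alpha>)"
    (is "_ = ?c * ?S")
  proof -
    have "of_nat n + (1 :: complex) \<noteq> 0"
      by (metis of_nat_Suc add.commute of_nat_neq_0)
    then show ?thesis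
      by (simp add: p_gen_fps_def poly_sum field_simps)
  qed
  also have "\<dots> = \<alpha> * (\<Sum>k=0..n. (-1) ^ Suc k * ((of_nat k + 1) / (of_nat k + 2)) *
      ((-1) ^ (n - k) * poly (p_poly (n - k)) \<alpha>))"
    unfolding sum_distrib_left
  proof (rule sum.cong[OF refl])
    fix k assume "k \<in> {0..n}"
    then have "(-1 :: complex) ^ Suc n = (-1) ^ Suc k * (-1) ^ (n - k)"
      by (simp flip: power_add)
    then show "?c * ((of_nat k + 1) / (of_nat k + 2) * poly (p_poly (n - k)) \<alpha>) =
        \<alpha> * ((-1) ^ Suc k * ((of_nat k + 1) / (of_nat k + 2)) * ((-1) ^ (n - k) * poly (p_poly (n - k)) \<alpha>))"
      by (simp only: mult_ac)
  qed
  also have "\<dots> = \<alpha> * fps_nth (fps_deriv Ln_quotient_fps * p_gen_fps \<alpha>) n"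
    unfolding fps_mult_nth
    by (intro arg_cong2[of _ _ _ _ "(*)"] refl sum.cong)
       (auto simp: Ln_quotient_fps_def p_gen_fps_def add_ac)
  finally show "fps_nth (fps_deriv (p_gen_fps \<alpha>)) n =
      fps_nth (fps_const \<alpha> * fps_deriv Ln_quotient_fps * p_gen_fps \<alpha>) n"
    by (simp add: mult.assoc)
qed

lemma fps_linear_ode_unique:
  fixes F G H :: "'a :: field_char_0 fps"
  assumes "fps_deriv F = H * F" "fps_deriv G = H * G" "fps_nth F 0 = fps_nth G 0"
  shows "F = G"
proof (rule fps_ext)
  show "fps_nth F n = fps_nth G n" for n
  proof (induction n rule: less_induct)
    case (less n)
    show ?case
    proof (cases n)
      case 0
      then show ?thesis using assms(3) by simp
    next
      case (Suc k)
      have "fps_nth (H * F) k = fps_nth (H * G) k"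
        unfolding fps_mult_nth using less Suc by (intro sum.cong) auto
      then have "fps_nth (fps_deriv F) k = fps_nth (fps_deriv G) k"
        using assms by simp
      then show ?thesis
        using Suc by (simp del: of_nat_Suc)
    qed
  qed
qed

lemma p_gen_fps_eq_exp:
  "p_gen_fps \<alpha> = fps_exp \<alpha> oo (Ln_quotient_fps - 1)"
proof (rule fps_linear_ode_unique)
  show "fps_deriv (p_gen_fps \<alpha>) = fps_const \<alpha> * fps_deriv Ln_quotient_fps * p_gen_fps \<alpha>"
    by (rule p_gen_fps_deriv)
  have "fps_nth (Ln_quotient_fps - 1) 0 = 0"
    by (simp add: Ln_quotient_fps_def)
  then show "fps_deriv (fps_exp \<alpha> oo (Ln_quotient_fps - 1)) =
      fps_const \<alpha> * fps_deriv Ln_quotient_fps * (fps_exp \<alpha> oo (Ln_quotient_fps - 1))"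
    by (simp add: fps_compose_deriv fps_compose_mult_distrib mult_ac)
qed (simp add: p_gen_fps_0)

lemma p_gen_fps_expansion:
  "(\<lambda>w. exp (\<alpha> * (Ln_quotient w - 1))) has_fps_expansion p_gen_fps \<alpha>"
proof -
  have "((\<lambda>w. exp (\<alpha> * w)) \<circ> (\<lambda>w. Ln_quotient w - 1)) has_fps_expansion
      (fps_exp \<alpha> oo (Ln_quotient_fps - 1))"
    by (intro has_fps_expansion_compose has_fps_expansion_exp has_fps_expansion_diff
        Ln_quotient_has_fps_expansion has_fps_expansion_1) (simp add: Ln_quotient_fps_def)
  then show ?thesis
    by (simp add: p_gen_fps_eq_exp o_def)
qed

lemma p_gen_fps_conv_radius: "1 \<le> fps_conv_radius (p_gen_fps \<alpha>)"
  and eval_p_gen_fps: "norm w < 1 \<Longrightarrow> eval_fps (p_gen_fps \<alpha>) w = exp (\<alpha> * (Ln_quotient w - 1))"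
proof -
  have hol: "(\<lambda>w. exp (\<alpha> * (Ln_quotient w - 1))) holomorphic_on ball 0 1"
    by (intro holomorphic_intros Ln_quotient_holomorphic)
  show "norm w < 1 \<Longrightarrow> eval_fps (p_gen_fps \<alpha>) w = exp (\<alpha> * (Ln_quotient w - 1))"
    using has_fps_expansion_imp_eval_fps_eq[OF p_gen_fps_expansion _ hol] .
  have "fps_expansion (\<lambda>w. exp (\<alpha> * (Ln_quotient w - 1))) 0 = p_gen_fps \<alpha>"
    by (simp add: fps_eq_iff fps_expansion_def flip: fps_nth_fps_expansion[OF p_gen_fps_expansion])
  then show "1 \<le> fps_conv_radius (p_gen_fps \<alpha>)"
    using conv_radius_fps_expansion[of _ 0 1] hol by (metis one_ereal_def eball_ereal)
qed

section \<open>The function off the cut\<close>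

definition cut_plane :: "complex set" where
  "cut_plane = {z. Im z \<noteq> 0 \<or> Re z < -1 \<or> Re z > 0}"

lemma open_cut_plane: "open cut_plane"
  unfolding cut_plane_def
  by (intro open_Collect_disj open_Collect_neq open_Collect_less continuous_intros)

text \<open>
  The cut of \<open>Ln\<close> is met exactly when \<open>z = 1 / (x - 1)\<close> for some real \<open>x \<le> 0\<close>, that is on
  \<open>[-1, 0[\<close>.
\<close>

lemma f_alpha_holomorphic: "f_alpha \<alpha> holomorphic_on cut_plane"
proof -
  have nz: "z \<noteq> 0" if "z \<in> cut_plane" for z
    using that by (auto simp: cut_plane_def)
  have "1 + 1 / z \<notin> \<real>\<^sub>\<le>\<^sub>0" if "z \<in> cut_plane" for z
  proof
    assume "1 + 1 / z \<in> \<real>\<^sub>\<le>\<^sub>0"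
    then obtain x where x: "x \<le> 0" "1 + 1 / z = of_real x"
      by (auto elim: nonpos_Reals_cases)
    then have "z = of_real (1 / (x - 1))"
      using nz[OF that] by (auto simp: field_simps)
    moreover have "-1 \<le> 1 / (x - 1)" "1 / (x - 1) \<le> 0"
      using x(1) by (auto simp: field_simps)
    ultimately show False
      using that by (simp add: cut_plane_def)
  qed
  then have "(\<lambda>z. exp \<alpha> - exp (\<alpha> * z * Ln (1 + 1 / z))) holomorphic_on cut_plane"
    using nz by (intro holomorphic_intros) auto
  then show ?thesis
    by (rule holomorphic_transform) (auto simp: f_alpha_def nz)
qed

text \<open>
  The imaginary part of \<open>Ln\<close> is bounded by \<open>\<pi>\<close> also on its cut, and the real part grows only
  logarithmically, so no approach region has to be excluded.
\<close>

lemma tendsto_mult_Ln_at_0: "((\<lambda>z. z * Ln (1 + 1 / z)) \<longlongrightarrow> 0) (at 0)"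
proof (rule Lim_null_comparison)
  have "filterlim (norm :: complex \<Rightarrow> real) (at_right 0) (at 0)"
    by (auto simp: filterlim_at eventually_at_filter intro!: tendsto_eq_intros)
  moreover have "((\<lambda>t. t * (ln (1 + 1 / t) + pi)) \<longlongrightarrow> 0) (at_right (0 :: real))"
    by real_asymp
  ultimately show "((\<lambda>z :: complex. norm z * (ln (1 + 1 / norm z) + pi)) \<longlongrightarrow> 0) (at 0)"
    by (rule filterlim_compose[rotated])
  show "\<forall>\<^sub>F z in at 0. norm (z * Ln (1 + 1 / z)) \<le> norm z * (ln (1 + 1 / norm z) + pi)"
    unfolding eventually_at
    \<comment> \<open>For \<open>norm z < 1/2\<close> the argument of \<open>Ln\<close> has modulus at least \<open>1\<close>, so the real part of \<open>Ln\<close>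
      is nonnegative and an upper bound on the modulus controls it.\<close>
  proof (intro exI[of _ "1/2"] conjI ballI impI)
    fix z :: complex assume z: "z \<noteq> 0 \<and> dist z 0 < 1/2"
    then have "1 / norm z \<ge> 2"
      by (simp add: field_simps)
    then have ge: "norm (1 + 1 / z) \<ge> 1"
      using norm_diff_ineq[of "1 / z" 1] by (simp add: norm_divide add.commute)
    have le: "norm (1 + 1 / z) \<le> 1 + 1 / norm z"
      using norm_triangle_ineq[of 1 "1 / z"] by (simp add: norm_divide)
    have nz: "1 + 1 / z \<noteq> 0"
      using ge by auto
    have "norm (Ln (1 + 1 / z)) \<le> \<bar>Re (Ln (1 + 1 / z))\<bar> + \<bar>Im (Ln (1 + 1 / z))\<bar>"
      by (rule cmod_le)
    also have "\<dots> \<le> ln (1 + 1 / norm z) + pi"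
      using ge le nz mpi_less_Im_Ln[OF nz] Im_Ln_le_pi[OF nz] by (intro add_mono) auto
    finally show "norm (z * Ln (1 + 1 / z)) \<le> norm z * (ln (1 + 1 / norm z) + pi)"
      by (simp add: norm_mult mult_left_mono)
  qed simp
qed

lemma isCont_f_alpha_0: "isCont (f_alpha \<alpha>) 0"
proof -
  have "((\<lambda>z. exp \<alpha> - exp (\<alpha> * (z * Ln (1 + 1 / z)))) \<longlongrightarrow> exp \<alpha> - exp (\<alpha> * 0)) (at 0)"
    by (intro tendsto_intros tendsto_mult_Ln_at_0)
  then have "(f_alpha \<alpha> \<longlongrightarrow> exp \<alpha> - exp (\<alpha> * 0)) (at 0)"
    by (rule tendsto_cong[THEN iffD1, rotated])
       (auto simp: f_alpha_def eventually_at_filter mult.assoc)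
  then show ?thesis
    by (simp add: isCont_def f_alpha_def)
qed

lemma continuous_on_f_alpha: "continuous_on (insert 0 cut_plane) (f_alpha \<alpha>)"
proof -
  have "isCont (f_alpha \<alpha>) z" if "z \<in> insert 0 cut_plane" for z
    using that isCont_f_alpha_0 f_alpha_holomorphic[of \<alpha>, THEN holomorphic_on_imp_continuous_on]
      continuous_on_eq_continuous_at[OF open_cut_plane]
    by blast
  then show ?thesis
    by (simp add: continuous_at_imp_continuous_on)
qed

section \<open>Moments and the power series\<close>

lemma f_alpha_eq_eval_fps:
  assumes "norm z > 1"
  shows "f_alpha \<alpha> z = eval_fps (fps_const (exp \<alpha>) * (1 - p_gen_fps \<alpha>)) (1 / z)"
proof -
  have z: "z \<noteq> 0"
    using assms by auto
  then have w: "norm (1 / z) < 1"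
    using assms by (simp add: norm_divide divide_less_eq)
  have r: "ereal (norm (1 / z)) < fps_conv_radius (p_gen_fps \<alpha>)"
    using w p_gen_fps_conv_radius[of \<alpha>]
    by (intro less_le_trans[of _ 1 "fps_conv_radius (p_gen_fps \<alpha>)"]) auto
  have "ereal (norm (1 / z)) < fps_conv_radius (1 - p_gen_fps \<alpha>)"
    using r by (intro less_le_trans[OF _ fps_conv_radius_diff]) simp
  then have "eval_fps (fps_const (exp \<alpha>) * (1 - p_gen_fps \<alpha>)) (1 / z) =
      exp \<alpha> * (1 - exp (\<alpha> * (Ln_quotient (1 / z) - 1)))"
    using r eval_p_gen_fps[OF w] by (simp add: eval_fps_mult eval_fps_diff)
  also have "\<dots> = exp \<alpha> - exp (\<alpha> * z * Ln (1 + 1 / z))"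
    using z by (simp add: Ln_quotient_def algebra_simps flip: exp_add)
  finally show ?thesis
    using z by (simp add: f_alpha_def)
qed

lemma path_image_C_rect_subset:
  assumes "r > 0" "c > 1"
  shows "path_image (C_rect r c) \<subseteq> insert 0 cut_plane"
  using assms
  by (auto simp: C_rect_def path_image_rectpath cut_plane_def complex_eq_iff)

text \<open>
  The contour is moved from \<open>C_rect r c\<close> to a rectangle with right side on \<open>Re z = 1\<close>, and
  then dilated from \<open>- 1 / 2\<close> until it surrounds the closed unit disc.
\<close>

lemma f_alpha_moment:
  assumes "r > 0" "c > 1"
  shows "contour_integral (C_rect r c) (\<lambda>z. f_alpha \<alpha> z * z ^ n) =
    2 * of_real pi * \<i> * exp \<alpha> * ((-1) ^ n * poly (p_poly (n + 1)) \<alpha>)"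
proof -
  define f where "f = (\<lambda>z. f_alpha \<alpha> z * z ^ n)"
  define a b where "a = Complex (- c) (- r)" and "b = Complex 1 r"
  have holf: "f holomorphic_on cut_plane"
    unfolding f_def by (intro holomorphic_intros f_alpha_holomorphic)
  have contf: "continuous_on (insert 0 cut_plane) f"
    unfolding f_def by (intro continuous_intros continuous_on_f_alpha)
  have "contour_integral (C_rect r c) f = contour_integral (rectpath a b) f"
    unfolding C_rect_def a_def b_def
  proof (rule contour_integral_rectpath_move_right_side)
    show "continuous_on (path_image (rectpath (Complex (- c) (- r)) (Complex 0 r)) \<union>
        cbox (Complex 0 (Im (Complex (- c) (- r)))) (Complex 1 r)) f"
      using path_image_C_rect_subset[OF assms]
      by (intro continuous_on_subset[OF contf])
         (auto simp: C_rect_def in_cbox_complex_iff cut_plane_def complex_eq_iff)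
    show "f field_differentiable at z"
      if "z \<in> box (Complex 0 (Im (Complex (- c) (- r)))) (Complex 1 r)" for z
      using that by (intro holomorphic_on_imp_differentiable_at[OF holf open_cut_plane])
        (auto simp: in_box_complex_iff cut_plane_def)
  qed (use assms in auto)
  \<comment> \<open>The horizontal sides of the dilated rectangle have imaginary part \<open>\<plusminus> k * r\<close>, and its left side
    has real part below \<open>- (1 + k) / 2\<close>; the choice of \<open>k\<close> puts them outside the unit disc.\<close>
  define k where "k = max 3 (2 / r)"
  define a' b' where "a' = - 1 / 2 + of_real k * (a - (- 1 / 2))"
    and "b' = - 1 / 2 + of_real k * (b - (- 1 / 2))"
  have k: "k \<ge> 3" "k * r \<ge> 2"
    using assms by (auto simp: k_def max_def field_simps)
  have kc: "k \<le> k * c"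
    using k assms by simp
  then have box: "cball 0 1 \<subseteq> box a' b'"
  proof -
    have "Re a' = - 1 / 2 - k * c + k / 2" "Re b' = - 1 / 2 + 3 / 2 * k"
      "Im a' = - (k * r)" "Im b' = k * r"
      by (simp_all add: a'_def b'_def a_def b_def algebra_simps)
    then have "-1 > Re a'" "1 < Re b'" "-1 > Im a'" "1 < Im b'"
      using k kc by linarith+
    moreover have "\<bar>Re z\<bar> \<le> 1" "\<bar>Im z\<bar> \<le> 1" if "z \<in> cball 0 1" for z
      using that abs_Re_le_cmod[of z] abs_Im_le_cmod[of z] by auto
    ultimately show ?thesis
      by (fastforce simp: in_box_complex_iff abs_le_iff)
  qed
  have "contour_integral (rectpath a b) f = contour_integral (rectpath a' b') f"
    unfolding a'_def b'_def
  proof (rule contour_integral_rectpath_dilate[OF _ _ open_cut_plane holf])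
    show "- box a b \<subseteq> cut_plane"
      using assms by (auto simp: in_box_complex_iff cut_plane_def a_def b_def)
  qed (use k assms in \<open>auto simp: in_box_complex_iff a_def b_def\<close>)
  define H where "H = fps_const (exp \<alpha>) * (1 - p_gen_fps \<alpha>)"
  have "0 \<in> box a' b'"
    using box by auto
  then have le: "Re a' \<le> Re b'" "Im a' \<le> Im b'"
    by (auto simp: in_box_complex_iff)
  have out: "path_image (rectpath a' b') \<inter> cball 0 1 = {}"
    using path_image_rectpath_inter_box[OF le] box by auto
  have "1 \<le> fps_conv_radius H"
    using p_gen_fps_conv_radius[of \<alpha>] fps_conv_radius_diff[of 1 "p_gen_fps \<alpha>"]
    by (auto simp: H_def fps_conv_radius_cmult_left)
  then have "((\<lambda>z. eval_fps H (1 / z) * z ^ (n + 1) / z) has_contour_integral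
      2 * of_real pi * \<i> * fps_nth H (n + 1)) (rectpath a' b')"
    by (rule has_contour_integral_eval_fps_inverse)
       (use out \<open>0 \<in> box a' b'\<close> winding_number_rectpath in auto)
  then have "(f has_contour_integral 2 * of_real pi * \<i> * fps_nth H (n + 1)) (rectpath a' b')"
  proof (rule has_contour_integral_eq)
    fix z assume "z \<in> path_image (rectpath a' b')"
    then have "norm z > 1"
      using out by (auto simp: disjoint_iff)
    then show "eval_fps H (1 / z) * z ^ (n + 1) / z = f z"
      by (auto simp: f_def H_def f_alpha_eq_eval_fps)
  qed
  moreover have "fps_nth H (n + 1) = exp \<alpha> * ((-1) ^ n * poly (p_poly (n + 1)) \<alpha>)"
    by (simp add: H_def p_gen_fps_def del: p_poly.simps)
  ultimately show ?thesis
    using \<open>contour_integral (C_rect r c) f = _\<close> \<open>contour_integral (rectpath a b) f = _\<close>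
    by (simp add: f_def contour_integral_unique mult.assoc del: p_poly.simps)
qed

lemma phi_sums:
  assumes "r > 0" "c > 1"
  shows "(\<lambda>n. exp \<alpha> * ((-1) ^ n * poly (p_poly (n + 1)) \<alpha> * (s ^ n / fact n))) sums phi r c \<alpha> s"
proof -
  have "continuous_on (path_image (C_rect r c)) (f_alpha \<alpha>)"
    by (rule continuous_on_subset[OF continuous_on_f_alpha path_image_C_rect_subset[OF assms]])
  then have "(\<lambda>n. contour_integral (C_rect r c) (\<lambda>z. f_alpha \<alpha> z * z ^ n) * (s ^ n / fact n))
      sums contour_integral (C_rect r c) (\<lambda>z. f_alpha \<alpha> z * exp (s * z))"
    unfolding C_rect_def by (rule contour_integral_rectpath_exp_sums) (use assms in auto)
  then have "(\<lambda>n. 1 / (2 * of_real pi * \<i>) *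
        (2 * of_real pi * \<i> * exp \<alpha> * ((-1) ^ n * poly (p_poly (n + 1)) \<alpha>) * (s ^ n / fact n)))
      sums phi r c \<alpha> s"
    unfolding phi_def f_alpha_moment[OF assms] by (rule sums_mult)
  then show ?thesis
    by (simp add: mult.assoc del: p_poly.simps)
qed

theorem theorem1p2:
  shows "p_poly 1 = [:0, 1/2:] \<and> p_poly 2 = [:0, 1/3, 1/8:] \<and>
    (\<forall>\<alpha> :: complex. \<forall>r c :: real. r > 0 \<longrightarrow> c > 1 \<longrightarrow>
       (\<forall>s :: complex.
          summable (\<lambda>n. (-1) ^ n * poly (p_poly (n + 1)) \<alpha> * (s ^ n / fact n)) \<and>
          phi r c \<alpha> s =
            exp \<alpha> * (\<Sum>n. (-1) ^ n * poly (p_poly (n + 1)) \<alpha> * (s ^ n / fact n))) \<and>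
       phi r c \<alpha> 0 = exp \<alpha> * \<alpha> / 2)"
proof (intro conjI allI impI)
  show p1: "p_poly 1 = [:0, 1/2:]"
    by (simp add: numeral_poly one_pCons)
  show "p_poly 2 = [:0, 1/3, 1/8:]"
    by (simp add: numeral_2_eq_2 one_pCons)
  fix \<alpha> :: complex and r c :: real
  assume rc: "r > 0" "c > 1"
  let ?t = "\<lambda>s n. (-1) ^ n * poly (p_poly (n + 1)) \<alpha> * (s ^ n / fact n)"
  show summable: "summable (?t s)" for s
    using sums_summable[OF phi_sums[OF rc, of \<alpha> s]] by (simp only: summable_cmult_iff) simp
  show series: "phi r c \<alpha> s = exp \<alpha> * (\<Sum>n. ?t s n)" for s
    using sums_unique2[OF phi_sums[OF rc] sums_mult[OF summable_sums[OF summable]]] .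
  have "(\<Sum>n. ?t 0 n) = poly (p_poly 1) \<alpha>"
    using powser_zero[of "\<lambda>n. (-1) ^ n * poly (p_poly (n + 1)) \<alpha> / fact n"] by simp
  then show "phi r c \<alpha> 0 = exp \<alpha> * \<alpha> / 2"
    unfolding series p1 by simp
qed

end
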